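(* Let $n\ge 2$ and $N\ge 1$ be integers, let $X(n,N)=\{\boldsymbol{x}=(x_0,\dots,x_{n-1})\in\mathbb{N}_0^n : x_0+\cdots+x_{n-1}=N\}$, and let $A=(a_{ij})_{1\le i,j\le n-1}\in M_{n-1}(\mathbb{C})$. Let $A_0=(a_{ij})_{0\le i,j\le n-1}\in M_n(\mathbb{C})$ be the matrix obtained from $A$ by setting $a_{0j}=a_{i0}=1$ for all $0\le i,j\le n-1$. For $\boldsymbol{x},\boldsymbol{m}\in X(n,N)$ define $\phi_A(\boldsymbol{x};\boldsymbol{m})$ by the generating function \[ \prod_{i=0}^{n-1}\Big(\sum_{j=0}^{n-1}a_{ij}t_j\Big)^{x_i}=\sum_{\boldsymbol{m}\in X(n,N)}\binom{N}{\boldsymbol{m}}\phi_A(\boldsymbol{x};\boldsymbol{m})\,t_0^{m_0}\cdots t_{n-1}^{m_{n-1}}, \] where $t_0,\dots,t_{n-1}$ are indeterminates. Let $\boldsymbol{\eta}_{(k)}=(\eta_{0k},\dots,\eta_{n-1,k})\in(\mathbb{C}\setminus\{0\})^n$ for $k=1,2$, let $D_k=\mathrm{diag}(\eta_{0k},\dots,\eta_{n-1,k})\in \mathrm{GL}_n(\mathbb{C})$, and set $b_n(\boldsymbol{x};N;\boldsymbol{\eta}_{(1)})=\binom{N}{\boldsymbol{x}}\prod_{j=0}^{n-1}\eta_{j1}^{x_j}$. Then the following are equivalent: (a) For all $\boldsymbol{m},\boldsymbol{m}'\in X(n,N)$, \[ \sum_{\boldsymbol{x}\in X(n,N)} b_n(\boldsymbol{x};N;\boldsymbol{\eta}_{(1)})\,\phi_A(\boldsymbol{x};\boldsymbol{m})\,\overline{\phi_A(\boldsymbol{x};\boldsymbol{m}')}=\delta_{\boldsymbol{m},\boldsymbol{m}'}\,\frac{\prod_{j=0}^{n-1}\eta_{j2}^{m_j}}{\binom{N}{\boldsymbol{m}}}.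 \] (b) There is an $N$th root of unity $\zeta$ such that $A_0^{*}D_1A_0=\zeta D_2$, where $A_0^*$ denotes the conjugate transpose of $A_0$.
   Context: $\mathbb{N}_0$ denotes the set of nonnegative integers. For $\boldsymbol{x}\in X(n,N)$, $\binom{N}{\boldsymbol{x}}=\frac{N!}{x_0!\cdots x_{n-1}!}$ is the multinomial coefficient. $\overline{z}$ denotes complex conjugation and $\delta$ the Kronecker delta. *)

theory Defs
  imports Complex_Main "HOL-Library.Poly_Mapping" "Jordan_Normal_Form.Schur_Decomposition"
begin

definition X :: "nat \<Rightarrow> nat \<Rightarrow> nat vec set" where
  "X n N = {x \<in> carrier_vec n. (\<Sum>i<n. x $ i) = N}"

definition multinomial :: "nat \<Rightarrow> nat \<Rightarrow> nat vec \<Rightarrow> complex" where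
  "multinomial n N x = fact N / (\<Prod>i<n. fact (x $ i))"

text \<open>The given matrix has its rows and columns numbered from 1 to n - 1 on paper, but from 0 to
  n - 2 as a value of type \<^typ>\<open>complex mat\<close>; hence the index shift.\<close>

definition bordered :: "nat \<Rightarrow> complex mat \<Rightarrow> complex mat" where
  "bordered n A = mat n n (\<lambda>(i, j). if i = 0 \<or> j = 0 then 1 else A $$ (i - 1, j - 1))"

text \<open>Polynomials over the complex numbers in the indeterminates t_0, t_1, ... are finitely
  supported maps from exponents to coefficients, with the convolution product.\<close>

type_synonym cpoly = "(nat \<Rightarrow>\<^sub>0 nat) \<Rightarrow>\<^sub>0 complex"

definition const :: "complex \<Rightarrow> cpoly" where
  "const c = Poly_Mapping.single 0 c"

definition indet :: "nat \<Rightarrow> cpoly" where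
  "indet j = Poly_Mapping.single (Poly_Mapping.single j 1) 1"

definition expnt :: "nat \<Rightarrow> nat vec \<Rightarrow> (nat \<Rightarrow>\<^sub>0 nat)" where
  "expnt n m = (\<Sum>j<n. Poly_Mapping.single j (m $ j))"

definition gen_poly :: "nat \<Rightarrow> complex mat \<Rightarrow> nat vec \<Rightarrow> cpoly" where
  "gen_poly n A x = (\<Prod>i<n. (\<Sum>j<n. const (bordered n A $$ (i, j)) * indet j) ^ (x $ i))"

text \<open>The generating function identity determines \<open>\<phi>\<close> by comparison of coefficients. That
  the function obtained in this way satisfies the identity, and is the only one to do so, is proved
  in \<open>\<phi>_generating_function\<close> and \<open>\<phi>_unique\<close>.\<close>

definition \<phi> :: "nat \<Rightarrow> nat \<Rightarrow> complex mat \<Rightarrow> nat vec \<Rightarrow> nat vec \<Rightarrow> complex" where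
  "\<phi> n N A x m = Poly_Mapping.lookup (gen_poly n A x) (expnt n m) / multinomial n N m"

definition b :: "nat \<Rightarrow> nat vec \<Rightarrow> nat \<Rightarrow> complex vec \<Rightarrow> complex" where
  "b n x N \<eta> = multinomial n N x * (\<Prod>j<n. (\<eta> $ j) ^ (x $ j))"

lemma lookup_expnt: "Poly_Mapping.lookup (expnt n m) j = (if j < n then m $ j else 0)"
  by (simp add: expnt_def lookup_sum lookup_single when_def)

lemma inj_on_expnt: "inj_on (expnt n) (X n N)"
proof (rule inj_onI)
  fix x y assume x: "x \<in> X n N" and y: "y \<in> X n N" and e: "expnt n x = expnt n y"
  have "x $ j = y $ j" if "j < n" for j
    using arg_cong[OF e, of "\<lambda>p. Poly_Mapping.lookup p j"] that by (simp add: lookup_expnt)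
  then show "x = y" using x y by (intro eq_vecI) (auto simp: X_def)
qed

lemma finite_X: "finite (X n N)"
proof -
  have "X n N \<subseteq> vec_of_list ` {xs. set xs \<subseteq> {..N} \<and> length xs = n}"
  proof
    fix x assume x: "x \<in> X n N"
    have "x $ i \<le> N" if "i < n" for i
      using x that member_le_sum[of i "{..<n}" "\<lambda>i. x $ i"] by (auto simp: X_def)
    then have "set (list_of_vec x) \<subseteq> {..N}"
      using x by (auto simp: X_def set_list_of_vec vec_set_def)
    moreover have "length (list_of_vec x) = n" using x by (auto simp: X_def)
    moreover have "x = vec_of_list (list_of_vec x)" by (simp add: vec_list)
    ultimately show "x \<in> vec_of_list ` {xs. set xs \<subseteq> {..N} \<and> length xs = n}" by blast
  qed
  then show ?thesis
    by (rule finite_subset) (intro finite_imageI finite_lists_length_eq finite_atMost)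
qed

lemma multinomial_nonzero: "multinomial n N m \<noteq> 0"
  by (simp add: multinomial_def)

definition homog :: "nat \<Rightarrow> nat \<Rightarrow> cpoly \<Rightarrow> bool" where
  "homog n d p \<longleftrightarrow> (\<forall>k \<in> Poly_Mapping.keys p.
     Poly_Mapping.keys k \<subseteq> {..<n} \<and> (\<Sum>j<n. Poly_Mapping.lookup k j) = d)"

lemma homog_mult:
  assumes "homog n d p" "homog n e q" shows "homog n (d + e) (p * q)"
  unfolding homog_def
proof
  fix k assume "k \<in> Poly_Mapping.keys (p * q)"
  then obtain a c where ac: "a \<in> Poly_Mapping.keys p" "c \<in> Poly_Mapping.keys q" "k = a + c"
    using keys_mult[of p q] by blast
  have "Poly_Mapping.keys a \<subseteq> {..<n}" "Poly_Mapping.keys c \<subseteq> {..<n}"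
    "(\<Sum>j<n. Poly_Mapping.lookup a j) = d" "(\<Sum>j<n. Poly_Mapping.lookup c j) = e"
    using assms ac by (auto simp: homog_def)
  then show "Poly_Mapping.keys k \<subseteq> {..<n} \<and> (\<Sum>j<n. Poly_Mapping.lookup k j) = d + e"
    using Poly_Mapping.keys_add[of a c] ac(3) by (simp add: lookup_add sum.distrib) blast
qed

lemma homog_one: "homog n 0 1"
  by (simp add: homog_def)

lemma homog_power: "homog n d p \<Longrightarrow> homog n (d * e) (p ^ e)"
proof (induction e)
  case (Suc e)
  then show ?case using homog_mult[of n d p "d * e" "p ^ e"] by simp
qed (simp add: homog_one)

lemma homog_prod:
  "finite I \<Longrightarrow> (\<And>i. i \<in> I \<Longrightarrow> homog n (d i) (p i)) \<Longrightarrow> homog n (sum d I) (prod p I)"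
  by (induction I rule: finite_induct) (simp_all add: homog_one homog_mult)

lemma homog_sum:
  assumes "\<And>i. i \<in> I \<Longrightarrow> homog n d (p i)" shows "homog n d (sum p I)"
proof (cases "finite I")
  case True
  then show ?thesis using assms
  proof (induction I rule: finite_induct)
    case empty then show ?case by (simp add: homog_def)
  next
    case (insert i I)
    have "homog n d (p i)" "homog n d (sum p I)" using insert by simp_all
    then have "homog n d (p i + sum p I)"
      unfolding homog_def using Poly_Mapping.keys_add[of "p i" "sum p I"] by blast
    then show ?case using insert.hyps by simp
  qed
qed (simp add: homog_def)

lemma homog_const_indet: "j < n \<Longrightarrow> homog n 1 (const c * indet j)"
  by (simp add: homog_def const_def indet_def mult_single lookup_single when_def)

lemma homog_gen_poly: "x \<in> X n N \<Longrightarrow> homog n N (gen_poly n A x)"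
proof -
  assume x: "x \<in> X n N"
  have "homog n (\<Sum>i<n. 1 * (x $ i)) (gen_poly n A x)"
    unfolding gen_poly_def
    by (intro homog_prod homog_power homog_sum homog_const_indet) auto
  then show ?thesis using x by (simp add: X_def)
qed

lemma indet_power: "indet j ^ k = Poly_Mapping.single (Poly_Mapping.single j k) 1"
  by (induction k) (simp_all add: indet_def mult_single flip: single_add)

lemma monomial_eq: "(\<Prod>j<n. indet j ^ (m $ j)) = Poly_Mapping.single (expnt n m) 1"
proof -
  have "(\<Prod>j<k. indet j ^ (m $ j)) =
      Poly_Mapping.single (\<Sum>j<k. Poly_Mapping.single j (m $ j)) 1" for k
    by (induction k) (simp_all add: indet_power mult_single)
  then show ?thesis by (simp add: expnt_def)
qed

lemma lookup_monomial_sum: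
  "Poly_Mapping.lookup (\<Sum>m \<in> X n N. const (f m) * (\<Prod>j<n. indet j ^ (m $ j))) k =
   (\<Sum>m \<in> X n N. f m when expnt n m = k)"
  by (simp add: lookup_sum monomial_eq const_def mult_single lookup_single)

lemma lookup_monomial_sum_expnt:
  assumes "m \<in> X n N"
  shows "Poly_Mapping.lookup (\<Sum>m \<in> X n N. const (f m) * (\<Prod>j<n. indet j ^ (m $ j)))
     (expnt n m) = f m"
proof -
  have "(\<Sum>m' \<in> X n N. f m' when expnt n m' = expnt n m) =
      (\<Sum>m' \<in> X n N. if m' = m then f m' else 0)"
    using assms inj_on_expnt[of n N] by (intro sum.cong) (auto simp: when_def inj_on_def)
  then show ?thesis using assms by (simp add: lookup_monomial_sum finite_X)
qed

theorem \<phi>_generating_function: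
  assumes "x \<in> X n N"
  shows "(\<Prod>i<n. (\<Sum>j<n. const (bordered n A $$ (i, j)) * indet j) ^ (x $ i)) =
    (\<Sum>m \<in> X n N. const (multinomial n N m * \<phi> n N A x m) * (\<Prod>j<n. indet j ^ (m $ j)))"
    (is "_ = ?R")
proof -
  have "gen_poly n A x = ?R"
  proof (rule poly_mapping_eqI)
    fix k
    show "Poly_Mapping.lookup (gen_poly n A x) k = Poly_Mapping.lookup ?R k"
    proof (cases "k \<in> expnt n ` X n N")
      case True
      then show ?thesis
        by (auto simp: lookup_monomial_sum_expnt \<phi>_def multinomial_nonzero)
    next
      case False
      have "k \<notin> Poly_Mapping.keys (gen_poly n A x)"
      proof
        assume k: "k \<in> Poly_Mapping.keys (gen_poly n A x)"
        let ?m = "vec n (Poly_Mapping.lookup k)"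
        have h: "Poly_Mapping.keys k \<subseteq> {..<n}" "(\<Sum>j<n. Poly_Mapping.lookup k j) = N"
          using homog_gen_poly[OF assms, of A] k by (auto simp: homog_def)
        have "?m \<in> X n N" using h by (simp add: X_def)
        moreover have "k = expnt n ?m"
          using h(1) by (intro poly_mapping_eqI) (auto simp: lookup_expnt in_keys_iff subset_iff)
        ultimately show False using False by blast
      qed
      moreover have "Poly_Mapping.lookup ?R k = 0"
        using False by (subst lookup_monomial_sum) (auto intro!: sum.neutral simp: when_def)
      ultimately show ?thesis by (simp add: in_keys_iff)
    qed
  qed
  then show ?thesis by (simp add: gen_poly_def)
qed

theorem \<phi>_unique:
  assumes "x \<in> X n N"
    and "(\<Prod>i<n. (\<Sum>j<n. const (bordered n A $$ (i, j)) * indet j) ^ (x $ i)) =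
      (\<Sum>m \<in> X n N. const (multinomial n N m * f m) * (\<Prod>j<n. indet j ^ (m $ j)))"
    and "m \<in> X n N"
  shows "f m = \<phi> n N A x m"
proof -
  have "multinomial n N m * f m = Poly_Mapping.lookup (gen_poly n A x) (expnt n m)"
    using lookup_monomial_sum_expnt[OF assms(3), of "\<lambda>m. multinomial n N m * f m"] assms(2)
    by (simp add: gen_poly_def)
  then show ?thesis using multinomial_nonzero[of n N m] by (simp add: \<phi>_def field_simps)
qed

end

theory Submission
  imports Defs
begin

text \<open>Put \<open>M = A\<^sub>0\<^sup>* D\<^sub>1 A\<^sub>0\<close>. Multiplying the sums in (a) by
  multinomial coefficients and by \<open>t\<^sup>m u\<^sup>m'\<close> and adding up, the multinomial theorem turns the
  left-hand sides into \<open>(u\<^sup>T M t)\<^sup>N\<close> and the right-hand sides into \<open>(u\<^sup>T D\<^sub>2 t)\<^sup>N\<close>. Comparing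
  coefficients, (a) says that these two powers agree for all \<open>u\<close> and \<open>t\<close>. In that case the bilinear
  forms of \<open>M\<close> and \<open>D\<^sub>2\<close> have the same zeros, which forces \<open>M\<close> to be a multiple of \<open>D\<^sub>2\<close>.\<close>

section \<open>Evaluation of formal polynomials at complex points\<close>

text \<open>Indeterminates with index at least \<open>n\<close> are sent to 1.\<close>

definition mpoly_eval :: "nat \<Rightarrow> (nat \<Rightarrow> complex) \<Rightarrow> cpoly \<Rightarrow> complex" where
  "mpoly_eval n t p = (\<Sum>k \<in> Poly_Mapping.keys p.
     Poly_Mapping.lookup p k * (\<Prod>j<n. t j ^ Poly_Mapping.lookup k j))"

lemma mpoly_eval_zero [simp]: "mpoly_eval n t 0 = 0"
  by (simp add: mpoly_eval_def)

lemma mpoly_eval_add: "mpoly_eval n t (p + q) = mpoly_eval n t p + mpoly_eval n t q"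
  unfolding mpoly_eval_def by (rule setsum_keys_plus_distrib) (simp_all add: distrib_right)

lemma mpoly_eval_single:
  "mpoly_eval n t (Poly_Mapping.single k c) = c * (\<Prod>j<n. t j ^ Poly_Mapping.lookup k j)"
  by (simp add: mpoly_eval_def)

lemma mpoly_eval_sum: "mpoly_eval n t (sum p I) = (\<Sum>i\<in>I. mpoly_eval n t (p i))"
  by (induction I rule: infinite_finite_induct) (simp_all add: mpoly_eval_add)

text \<open>\<open>update_induct\<close> builds a polynomial by updates at fresh exponents; as sums,
  these steps become accessible to additivity of evaluation.\<close>

lemma update_eq_single_add:
  assumes "k \<notin> Poly_Mapping.keys p"
  shows "Poly_Mapping.update k c p = Poly_Mapping.single k c + p"
  using assms
  by (intro poly_mapping_eqI) (auto simp: lookup_update lookup_add lookup_single when_def in_keys_iff)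

text \<open>Multiplicativity for a monomial factor comes first, by induction on the other factor;
  \<open>mpoly_eval_mult\<close> then inducts on the first one.\<close>

lemma mpoly_eval_single_mult:
  "mpoly_eval n t (Poly_Mapping.single k c * q) = mpoly_eval n t (Poly_Mapping.single k c) * mpoly_eval n t q"
proof (induction q rule: update_induct)
  case (update q l d)
  then show ?case
    by (simp add: update_eq_single_add distrib_left mpoly_eval_add mult_single mpoly_eval_single
        lookup_add power_add prod.distrib)
qed simp

lemma mpoly_eval_mult: "mpoly_eval n t (p * q) = mpoly_eval n t p * mpoly_eval n t q"
proof (induction p rule: update_induct)
  case (update p l d)
  then show ?case
    by (simp add: update_eq_single_add distrib_right mpoly_eval_add mpoly_eval_single_mult)
qed simp

lemma mpoly_eval_one [simp]: "mpoly_eval n t 1 = 1"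
  using mpoly_eval_single[of n t 0 1] by simp

lemma mpoly_eval_power: "mpoly_eval n t (p ^ e) = mpoly_eval n t p ^ e"
  by (induction e) (simp_all add: mpoly_eval_mult)

lemma mpoly_eval_prod: "mpoly_eval n t (prod p I) = (\<Prod>i\<in>I. mpoly_eval n t (p i))"
  by (induction I rule: infinite_finite_induct) (simp_all add: mpoly_eval_mult)

lemma mpoly_eval_const [simp]: "mpoly_eval n t (const c) = c"
  by (simp add: const_def mpoly_eval_single)

lemma mpoly_eval_indet: "j < n \<Longrightarrow> mpoly_eval n t (indet j) = t j"
proof -
  assume "j < n"
  have "(\<Prod>i<n. t i ^ Poly_Mapping.lookup (Poly_Mapping.single j 1) i) = (\<Prod>i<n. if i = j then t i else 1)"
    by (intro prod.cong) (auto simp: lookup_single when_def)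
  then show ?thesis
    using \<open>j < n\<close> by (simp add: indet_def mpoly_eval_single)
qed

text \<open>Evaluation is a ring homomorphism, so it carries the formal identity to one between
  complex numbers.\<close>

lemma \<phi>_generating_function_eval:
  assumes "x \<in> X n N"
  shows "(\<Prod>i<n. (\<Sum>j<n. bordered n A $$ (i, j) * t j) ^ (x $ i)) =
    (\<Sum>m \<in> X n N. multinomial n N m * \<phi> n N A x m * (\<Prod>j<n. t j ^ (m $ j)))"
  using arg_cong[OF \<phi>_generating_function[OF assms, of A], of "mpoly_eval n t"]
  by (simp add: mpoly_eval_prod mpoly_eval_power mpoly_eval_sum mpoly_eval_mult mpoly_eval_indet)

section \<open>Multinomial theorem over exponent vectors\<close>

text \<open>Splitting off the last entry \<open>k\<close> prepares an induction on the number of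
  variables. The bound \<open>k \<le> N\<close> keeps \<open>N - k\<close> from truncating.\<close>

lemma X_Suc_eq:
  "X (Suc n) N = (\<Union>k\<le>N. (\<lambda>x. vec (Suc n) (\<lambda>i. if i < n then x $ i else k)) ` X n (N - k))"
  (is "_ = (\<Union>k\<le>N. ?s k ` _)")
proof (intro equalityI subsetI)
  fix x assume x: "x \<in> X (Suc n) N"
  then have "x = ?s (x $ n) (vec n (\<lambda>i. x $ i))"
    by (intro eq_vecI) (auto simp: X_def less_Suc_eq)
  moreover have "vec n (\<lambda>i. x $ i) \<in> X n (N - x $ n)" "x $ n \<le> N"
    using x by (auto simp: X_def)
  ultimately show "x \<in> (\<Union>k\<le>N. ?s k ` X n (N - k))" by blast
qed (auto simp: X_def)

lemma sum_X_Suc: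
  "(\<Sum>x \<in> X (Suc n) N. f x) =
   (\<Sum>k\<le>N. \<Sum>x \<in> X n (N - k). f (vec (Suc n) (\<lambda>i. if i < n then x $ i else k)))"
  (is "_ = (\<Sum>k\<le>N. \<Sum>x \<in> _. f (?s k x))")
proof -
  have inj: "inj_on (?s k) (X n (N - k))" for k
  proof (rule inj_onI)
    fix x y assume xy: "x \<in> X n (N - k)" "y \<in> X n (N - k)" "?s k x = ?s k y"
    have "x $ i = y $ i" if "i < n" for i
      using arg_cong[OF xy(3), of "\<lambda>v. v $ i"] that by simp
    then show "x = y" using xy by (intro eq_vecI) (auto simp: X_def)
  qed
  have disj: "?s k ` X n (N - k) \<inter> ?s l ` X n (N - l) = {}" if "k \<noteq> l" for k l
  proof -
    have "?s k x $ n \<noteq> ?s l y $ n" for x y using that by simp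
    then show ?thesis by (metis (no_types, lifting) disjoint_iff imageE)
  qed
  show ?thesis
    unfolding X_Suc_eq
    by (subst sum.UNION_disjoint) (use disj inj in \<open>auto simp: finite_X sum.reindex\<close>)
qed

text \<open>Induction on \<open>n\<close>: the binomial theorem separates the last variable, and the
  induction hypothesis expands the remaining power.\<close>

lemma multinomial_theorem:
  fixes y :: "nat \<Rightarrow> complex"
  shows "(\<Sum>i<n. y i) ^ N = (\<Sum>x \<in> X n N. multinomial n N x * (\<Prod>i<n. y i ^ (x $ i)))"
proof (induction n arbitrary: N)
  case 0
  \<comment> \<open>With no variables, both sides are 1 for \<open>N = 0\<close> and 0
    otherwise.\<close>
  have "X 0 N = (if N = 0 then {vNil} else {})"
    by (auto simp: X_def)
  then show ?case by (simp add: multinomial_def)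
next
  case (Suc n)
  let ?s = "\<lambda>k x. vec (Suc n) (\<lambda>i. if i < n then x $ i else k)"
  have summand: "multinomial (Suc n) N (?s k x) * (\<Prod>i<Suc n. y i ^ (?s k x $ i)) =
      of_nat (N choose k) * y n ^ k * (multinomial n (N - k) x * (\<Prod>i<n. y i ^ (x $ i)))"
    if "k \<le> N" for k x
    using that by (simp add: multinomial_def binomial_fact mult_ac)
  have "(\<Sum>i<Suc n. y i) ^ N = (\<Sum>k\<le>N. of_nat (N choose k) * y n ^ k * (\<Sum>i<n. y i) ^ (N - k))"
    by (simp add: add.commute[of _ "y n"] binomial_ring)
  also have "\<dots> = (\<Sum>x \<in> X (Suc n) N. multinomial (Suc n) N x * (\<Prod>i<Suc n. y i ^ (x $ i)))"
    unfolding sum_X_Suc using Suc.IH summand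
    by (intro sum.cong) (simp_all add: sum_distrib_left del: prod.lessThan_Suc)
  finally show ?case .
qed

section \<open>Linear independence of monomials of fixed degree\<close>

text \<open>Digits in base \<open>B\<close> are unique: reduction mod \<open>B\<close> recovers the
  lowest one, and the induction treats the remaining ones.\<close>

lemma radix_sum_inj:
  fixes x y :: "nat \<Rightarrow> nat"
  assumes "\<And>i. i < n \<Longrightarrow> x i < B" "\<And>i. i < n \<Longrightarrow> y i < B"
    and "(\<Sum>i<n. x i * B ^ i) = (\<Sum>i<n. y i * B ^ i)" and "j < n"
  shows "x j = y j"
  using assms
proof (induction n arbitrary: x y j)
  case (Suc n)
  have split: "(\<Sum>i<Suc n. z i * B ^ i) = z 0 + B * (\<Sum>i<n. z (Suc i) * B ^ i)" for z
    by (simp only: sum.lessThan_Suc_shift) (simp add: sum_distrib_left mult_ac)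
  have eq: "x 0 + B * (\<Sum>i<n. x (Suc i) * B ^ i) = y 0 + B * (\<Sum>i<n. y (Suc i) * B ^ i)"
    using Suc.prems(3) by (simp only: split)
  have lt: "x 0 < B" "y 0 < B" using Suc.prems by auto
  have "x 0 = y 0" using arg_cong[OF eq, of "\<lambda>z. z mod B"] lt by simp
  with eq lt have tails: "(\<Sum>i<n. x (Suc i) * B ^ i) = (\<Sum>i<n. y (Suc i) * B ^ i)"
    by simp
  show ?case
  proof (cases j)
    case 0
    with \<open>x 0 = y 0\<close> show ?thesis by simp
  next
    case (Suc i)
    have "x (Suc i) = y (Suc i)"
      by (rule Suc.IH[OF _ _ tails]) (use Suc Suc.prems(1,2,4) in auto)
    with Suc show ?thesis by simp
  qed
qed simp

text \<open>Kronecker's substitution \<open>t\<^sub>j = z ^ (N + 1) ^ j\<close> sends distinct monomials of degree \<open>N\<close> to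
  distinct powers of \<open>z\<close>.\<close>

lemma monomials_independent:
  fixes c d :: "nat vec \<Rightarrow> complex"
  assumes "\<And>t. (\<Sum>m \<in> X n N. c m * (\<Prod>j<n. t j ^ (m $ j))) = (\<Sum>m \<in> X n N. d m * (\<Prod>j<n. t j ^ (m $ j)))"
    and "m \<in> X n N"
  shows "c m = d m"
proof -
  define e where "e m = (\<Sum>j<n. m $ j * Suc N ^ j)" for m :: "nat vec"
  define P where "P c = (\<Sum>m \<in> X n N. monom (c m) (e m))" for c :: "nat vec \<Rightarrow> complex"
  \<comment> \<open>Entries of an exponent vector are at most \<open>N\<close>, hence legitimate
    digits in base \<open>Suc N\<close>.\<close>
  have le: "x $ j < Suc N" if "x \<in> X n N" "j < n" for x j
    using that member_le_sum[of j "{..<n}" "\<lambda>i. x $ i"] by (auto simp: X_def)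
  have inj: "x = y" if "x \<in> X n N" "y \<in> X n N" "e x = e y" for x y
  proof -
    have "x $ j = y $ j" if "j < n" for j
      using radix_sum_inj[of n "\<lambda>i. x $ i" "Suc N" "\<lambda>i. y $ i" j] le
        \<open>x \<in> X n N\<close> \<open>y \<in> X n N\<close> \<open>e x = e y\<close> that unfolding e_def by blast
    then show ?thesis using that by (intro eq_vecI) (auto simp: X_def)
  qed
  have "poly (P c) z = (\<Sum>m \<in> X n N. c m * (\<Prod>j<n. (z ^ Suc N ^ j) ^ (m $ j)))" for c z
    by (simp add: P_def e_def poly_sum poly_monom power_sum mult.commute flip: power_mult)
  \<comment> \<open>By the hypothesis at Kronecker's point, \<open>P c\<close> and
    \<open>P d\<close> agree at every complex number, hence as polynomials.\<close>
  then have "P c = P d"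
    using assms(1) by (simp add: fun_eq_iff flip: poly_eq_poly_eq_iff)
  moreover have "coeff (P c) (e m) = c m" for c
  proof -
    have "coeff (P c) (e m) = (\<Sum>x \<in> X n N. if x = m then c x else 0)"
      unfolding P_def coeff_sum using inj assms(2) by (intro sum.cong) auto
    then show ?thesis using assms(2) by (simp add: finite_X)
  qed
  ultimately show ?thesis by metis
qed

section \<open>Generating function of the orthogonality sums\<close>

lemma mat_adjoint_diag_mult_index:
  fixes B :: "complex mat"
  assumes "B \<in> carrier_mat n n" "i < n" "j < n"
  shows "(mat_adjoint B * mat_diag n f * B) $$ (i, j) = (\<Sum>k<n. f k * cnj (B $$ (k, i)) * B $$ (k, j))"
proof -
  have adj: "mat_adjoint B \<in> carrier_mat n n"
    using assms by (auto simp: mat_adjoint_def)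
  have ent: "mat_adjoint B $$ (i, k) = cnj (B $$ (k, i))" if "k < n" for k
    using assms that by (simp add: mat_adjoint_def mat_of_rows_index cols_def)
  show ?thesis
    unfolding mat_diag_mult_right[OF adj]
    using assms ent by (auto simp: scalar_prod_def lessThan_atLeast0 mult_ac intro!: sum.cong)
qed

text \<open>Once the sum over \<open>x\<close> is outermost, each summand factors into two
  generating functions, one of them conjugated. The multinomial theorem in \<open>x\<close> then
  sums the products.\<close>

lemma gram_generating_function:
  "(\<Sum>m \<in> X n N. (\<Sum>m' \<in> X n N. multinomial n N m * multinomial n N m' *
       (\<Sum>x \<in> X n N. b n x N \<eta> * \<phi> n N A x m * cnj (\<phi> n N A x m')) *
       (\<Prod>j<n. u j ^ (m' $ j))) * (\<Prod>j<n. t j ^ (m $ j))) =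
   (\<Sum>i<n. \<Sum>j<n. (mat_adjoint (bordered n A) * mat_diag n (($) \<eta>) * bordered n A) $$ (i, j) * u i * t j) ^ N"
proof -
  let ?a = "\<lambda>i j. bordered n A $$ (i, j)"
  let ?mon = "\<lambda>t m. \<Prod>j<n. t j ^ (m $ j)"
  have t: "(\<Prod>i<n. (\<Sum>j<n. ?a i j * t j) ^ (x $ i)) =
      (\<Sum>m \<in> X n N. multinomial n N m * \<phi> n N A x m * ?mon t m)" if "x \<in> X n N" for x
    using \<phi>_generating_function_eval[OF that] .
  have cnj_multinomial: "cnj (multinomial n N m) = multinomial n N m" for m
    by (simp add: multinomial_def)
  \<comment> \<open>Evaluating at the conjugate of \<open>u\<close> and conjugating the identity
    leaves \<open>u\<close> itself unconjugated, so the result is polynomial in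
    \<open>u\<close>.\<close>
  have u: "(\<Prod>i<n. (\<Sum>j<n. cnj (?a i j) * u j) ^ (x $ i)) =
      (\<Sum>m \<in> X n N. multinomial n N m * cnj (\<phi> n N A x m) * ?mon u m)" if "x \<in> X n N" for x
    using arg_cong[OF \<phi>_generating_function_eval[OF that, of A "\<lambda>j. cnj (u j)"], of cnj]
    by (simp add: cnj_multinomial)
  have "(\<Sum>m \<in> X n N. (\<Sum>m' \<in> X n N. multinomial n N m * multinomial n N m' *
       (\<Sum>x \<in> X n N. b n x N \<eta> * \<phi> n N A x m * cnj (\<phi> n N A x m')) * ?mon u m') * ?mon t m) =
     (\<Sum>m \<in> X n N. \<Sum>m' \<in> X n N. \<Sum>x \<in> X n N. b n x N \<eta> *
       (multinomial n N m * \<phi> n N A x m * ?mon t m) *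
       (multinomial n N m' * cnj (\<phi> n N A x m') * ?mon u m'))"
    by (simp add: sum_distrib_left sum_distrib_right mult_ac)
  also have "\<dots> = (\<Sum>m \<in> X n N. \<Sum>x \<in> X n N. \<Sum>m' \<in> X n N. b n x N \<eta> *
       (multinomial n N m * \<phi> n N A x m * ?mon t m) *
       (multinomial n N m' * cnj (\<phi> n N A x m') * ?mon u m'))"
    by (intro sum.cong refl sum.swap)
  also have "\<dots> = (\<Sum>x \<in> X n N. \<Sum>m \<in> X n N. \<Sum>m' \<in> X n N. b n x N \<eta> *
       (multinomial n N m * \<phi> n N A x m * ?mon t m) *
       (multinomial n N m' * cnj (\<phi> n N A x m') * ?mon u m'))"
    by (rule sum.swap)
  also have "\<dots> = (\<Sum>x \<in> X n N. b n x N \<eta> *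
       (\<Sum>m \<in> X n N. multinomial n N m * \<phi> n N A x m * ?mon t m) *
       (\<Sum>m' \<in> X n N. multinomial n N m' * cnj (\<phi> n N A x m') * ?mon u m'))"
    by (simp only: mult.assoc sum_product) (simp only: sum_distrib_left mult.assoc)
  \<comment> \<open>The monomial in \<open>\<eta>\<close> contained in \<open>b\<close> merges with
    the two products into powers with exponents \<open>x $ i\<close>.\<close>
  also have "\<dots> = (\<Sum>x \<in> X n N. multinomial n N x *
      (\<Prod>i<n. (\<eta> $ i * (\<Sum>j<n. ?a i j * t j) * (\<Sum>j<n. cnj (?a i j) * u j)) ^ (x $ i)))"
    by (intro sum.cong) (simp_all add: b_def power_mult_distrib prod.distrib mult.assoc t u)
  also have "\<dots> = (\<Sum>k<n. \<eta> $ k * (\<Sum>j<n. ?a k j * t j) * (\<Sum>i<n. cnj (?a k i) * u i)) ^ N"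
    by (rule multinomial_theorem[symmetric])
  \<comment> \<open>The sum over \<open>k\<close> is moved innermost, where it becomes an entry of
    the matrix product.\<close>
  also have "(\<Sum>k<n. \<eta> $ k * (\<Sum>j<n. ?a k j * t j) * (\<Sum>i<n. cnj (?a k i) * u i)) =
     (\<Sum>k<n. \<Sum>j<n. \<Sum>i<n. \<eta> $ k * cnj (?a k i) * ?a k j * u i * t j)"
    by (simp add: sum_distrib_left sum_distrib_right mult_ac)
  also have "\<dots> = (\<Sum>j<n. \<Sum>k<n. \<Sum>i<n. \<eta> $ k * cnj (?a k i) * ?a k j * u i * t j)"
    by (rule sum.swap)
  also have "\<dots> = (\<Sum>j<n. \<Sum>i<n. \<Sum>k<n. \<eta> $ k * cnj (?a k i) * ?a k j * u i * t j)"
    by (intro sum.cong refl sum.swap)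
  also have "\<dots> = (\<Sum>i<n. \<Sum>j<n. \<Sum>k<n. \<eta> $ k * cnj (?a k i) * ?a k j * u i * t j)"
    by (rule sum.swap)
  also have "\<dots> = (\<Sum>i<n. \<Sum>j<n.
      (mat_adjoint (bordered n A) * mat_diag n (($) \<eta>) * bordered n A) $$ (i, j) * u i * t j)"
    by (intro sum.cong refl, subst mat_adjoint_diag_mult_index)
      (auto simp: bordered_def sum_distrib_right)
  finally show ?thesis .
qed

text \<open>Both families of values have generating functions that are Nth powers of bilinear forms.
  Passing to them loses nothing, since multinomial coefficients are nonzero and monomials are
  independent.\<close>

lemma orthogonality_iff_forms_power_eq:
  "(\<forall>m \<in> X n N. \<forall>m' \<in> X n N.
      (\<Sum>x \<in> X n N. b n x N \<eta>1 * \<phi> n N A x m * cnj (\<phi> n N A x m')) =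
      (if m = m' then (\<Prod>j<n. (\<eta>2 $ j) ^ (m $ j)) / multinomial n N m else 0)) \<longleftrightarrow>
   (\<forall>u t. (\<Sum>i<n. \<Sum>j<n.
      (mat_adjoint (bordered n A) * mat_diag n (($) \<eta>1) * bordered n A) $$ (i, j) * u i * t j) ^ N =
      (\<Sum>i<n. \<eta>2 $ i * u i * t i) ^ N)"
  (is "(\<forall>m \<in> _. \<forall>m' \<in> _. ?S m m' = ?E m m') \<longleftrightarrow> (\<forall>u t. ?L u t = ?R u t)")
proof -
  let ?\<mu> = "multinomial n N"
  let ?mon = "\<lambda>t m. \<Prod>j<n. t j ^ (m $ j)"
  \<comment> \<open>The Kronecker delta collapses the inner sum, and the denominator cancels one of
    the two multinomial coefficients; what remains is a multinomial expansion.\<close>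
  have R: "(\<Sum>m \<in> X n N. (\<Sum>m' \<in> X n N. ?\<mu> m * ?\<mu> m' * ?E m m' * ?mon u m') * ?mon t m) = ?R u t" for u t
  proof -
    have "(\<Sum>m' \<in> X n N. ?\<mu> m * ?\<mu> m' * ?E m m' * ?mon u m') = ?\<mu> m * ?mon (($) \<eta>2) m * ?mon u m"
      if "m \<in> X n N" for m
    proof -
      have "(\<Sum>m' \<in> X n N. ?\<mu> m * ?\<mu> m' * ?E m m' * ?mon u m') =
        (\<Sum>m' \<in> X n N. if m = m' then ?\<mu> m * ?mon (($) \<eta>2) m * ?mon u m else 0)"
        by (intro sum.cong) (auto simp: multinomial_nonzero)
      then show ?thesis using that by (simp add: finite_X)
    qed
    then show ?thesis
      by (simp add: multinomial_theorem power_mult_distrib prod.distrib mult.assoc)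
  qed
  show ?thesis
  proof
    assume "\<forall>m \<in> X n N. \<forall>m' \<in> X n N. ?S m m' = ?E m m'"
    then show "\<forall>u t. ?L u t = ?R u t"
      unfolding gram_generating_function[symmetric] R[symmetric] by simp
  next
    assume eq: "\<forall>u t. ?L u t = ?R u t"
    show "\<forall>m \<in> X n N. \<forall>m' \<in> X n N. ?S m m' = ?E m m'"
    proof (intro ballI)
      fix m m' assume m: "m \<in> X n N" "m' \<in> X n N"
      \<comment> \<open>Coefficients are compared first in \<open>t\<close> with \<open>u\<close>
        fixed, then in \<open>u\<close>.\<close>
      have "(\<Sum>m' \<in> X n N. ?\<mu> m * ?\<mu> m' * ?S m m' * ?mon u m') =
          (\<Sum>m' \<in> X n N. ?\<mu> m * ?\<mu> m' * ?E m m' * ?mon u m')" for u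
        by (rule monomials_independent[OF _ m(1)])
          (use eq in \<open>simp only: R gram_generating_function\<close>)
      then have "?\<mu> m * ?\<mu> m' * ?S m m' = ?\<mu> m * ?\<mu> m' * ?E m m'"
        by (rule monomials_independent[OF _ m(2)])
      then show "?S m m' = ?E m m'" by (simp add: multinomial_nonzero)
    qed
  qed
qed

section \<open>Bilinear forms with equal Nth powers\<close>

text \<open>Unit vectors kill the off-diagonal entries of \<open>M\<close> and determine each
  diagonal entry only up to its own Nth root of unity. The proportionality \<open>ratio\<close>
  forces these roots to coincide.\<close>

lemma forms_power_eq_iff:
  fixes M :: "complex mat" and d :: "nat \<Rightarrow> complex"
  assumes "M \<in> carrier_mat n n" "n > 0" "N > 0" and d: "\<And>i. i < n \<Longrightarrow> d i \<noteq> 0"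
  shows "(\<forall>u t. (\<Sum>i<n. \<Sum>j<n. M $$ (i, j) * u i * t j) ^ N = (\<Sum>i<n. d i * u i * t i) ^ N) \<longleftrightarrow>
    (\<exists>\<zeta>. \<zeta> ^ N = 1 \<and> M = \<zeta> \<cdot>\<^sub>m mat_diag n d)"
proof
  assume eq: "\<forall>u t. (\<Sum>i<n. \<Sum>j<n. M $$ (i, j) * u i * t j) ^ N = (\<Sum>i<n. d i * u i * t i) ^ N"
  define e :: "nat \<Rightarrow> nat \<Rightarrow> complex" where "e k i = (if i = k then 1 else 0)" for k i
  have e_sum: "(\<Sum>i<n. f i * e k i) = f k" if "k < n" for f k
    using that by (simp add: e_def if_distrib cong: if_cong)
  have unit: "M $$ (k, l) ^ N = (if k = l then d k else 0) ^ N" if "k < n" "l < n" for k l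
  proof -
    have "(\<Sum>i<n. \<Sum>j<n. M $$ (i, j) * e k i * e l j) = M $$ (k, l)"
      using that by (simp add: e_sum)
    moreover have "(\<Sum>i<n. d i * e k i * e l i) = (if k = l then d k else 0)"
      using that by (simp add: e_sum) (simp add: e_def)
    ultimately show ?thesis using eq[rule_format, of "e k" "e l"] by simp
  qed
  have off: "M $$ (k, l) = 0" if "k < n" "l < n" "k \<noteq> l" for k l
    using unit[OF that(1,2)] that \<open>N > 0\<close> by (simp add: zero_power)
  \<comment> \<open>The two forms have the same zeros; test on a zero supported on the coordinates 0 and k.\<close>
  have ratio: "M $$ (0, 0) * d k = M $$ (k, k) * d 0" if "0 < k" "k < n" for k
  proof -
    \<comment> \<open>Paired with the constant vector 1, these weights make the form of
      \<open>d\<close> cancel to \<open>d 0 * d k - d k * d 0\<close>.\<close>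
    define u where "u i = d k * e 0 i - d 0 * e k i" for i
    have "(\<Sum>j<n. M $$ (i, j) * u i * 1) = M $$ (i, i) * u i" if "i < n" for i
    proof -
      have "(\<Sum>j<n. M $$ (i, j) * u i * 1) = (\<Sum>j<n. if j = i then M $$ (i, i) * u i else 0)"
        using off that by (intro sum.cong) auto
      then show ?thesis using that by simp
    qed
    then have "(\<Sum>i<n. \<Sum>j<n. M $$ (i, j) * u i * 1) = (\<Sum>i<n. M $$ (i, i) * u i)"
      by simp
    also have "\<dots> = M $$ (0, 0) * d k - M $$ (k, k) * d 0"
      using that by (simp add: u_def right_diff_distrib sum_subtractf e_sum flip: mult.assoc)
    finally have M: "(\<Sum>i<n. \<Sum>j<n. M $$ (i, j) * u i * 1) = M $$ (0, 0) * d k - M $$ (k, k) * d 0" .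
    have "(\<Sum>i<n. d i * u i * 1) = 0"
      using that by (simp add: u_def right_diff_distrib sum_subtractf e_sum flip: mult.assoc)
    then have "(M $$ (0, 0) * d k - M $$ (k, k) * d 0) ^ N = 0"
      using eq[rule_format, of u "\<lambda>_. 1"] \<open>N > 0\<close> unfolding M by (simp add: zero_power)
    then show ?thesis by simp
  qed
  \<comment> \<open>The root is read off at index 0; \<open>ratio\<close> carries it to the other
    diagonal entries.\<close>
  let ?\<zeta> = "M $$ (0, 0) / d 0"
  have "?\<zeta> ^ N = 1"
    using unit[of 0 0] d[of 0] \<open>n > 0\<close> by (simp add: power_divide)
  moreover have "M = ?\<zeta> \<cdot>\<^sub>m mat_diag n d"
  proof (rule eq_matI)
    fix i j assume "i < dim_row (?\<zeta> \<cdot>\<^sub>m mat_diag n d)" "j < dim_col (?\<zeta> \<cdot>\<^sub>m mat_diag n d)"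
    then have ij: "i < n" "j < n" by (simp_all add: mat_diag_def)
    show "M $$ (i, j) = (?\<zeta> \<cdot>\<^sub>m mat_diag n d) $$ (i, j)"
      using ij off[of i j] ratio[of i] d[of 0] \<open>n > 0\<close>
      by (cases "i = 0") (auto simp: mat_diag_def field_simps)
  qed (use assms in \<open>auto simp: mat_diag_def\<close>)
  ultimately show "\<exists>\<zeta>. \<zeta> ^ N = 1 \<and> M = \<zeta> \<cdot>\<^sub>m mat_diag n d" by blast
next
  assume "\<exists>\<zeta>. \<zeta> ^ N = 1 \<and> M = \<zeta> \<cdot>\<^sub>m mat_diag n d"
  then obtain \<zeta> where \<zeta>: "\<zeta> ^ N = 1" "M = \<zeta> \<cdot>\<^sub>m mat_diag n d" by blast
  have "(\<Sum>i<n. \<Sum>j<n. M $$ (i, j) * u i * t j) = \<zeta> * (\<Sum>i<n. d i * u i * t i)" for u t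
  proof -
    have "(\<Sum>j<n. M $$ (i, j) * u i * t j) = \<zeta> * (d i * u i * t i)" if "i < n" for i
    proof -
      have "(\<Sum>j<n. M $$ (i, j) * u i * t j) = (\<Sum>j<n. if j = i then \<zeta> * (d i * u i * t i) else 0)"
        using that by (intro sum.cong) (auto simp: \<zeta>(2) mat_diag_def)
      then show ?thesis using that by simp
    qed
    then show ?thesis by (simp add: sum_distrib_left)
  qed
  then show "\<forall>u t. (\<Sum>i<n. \<Sum>j<n. M $$ (i, j) * u i * t j) ^ N = (\<Sum>i<n. d i * u i * t i) ^ N"
    by (simp add: power_mult_distrib \<zeta>(1))
qed

theorem theorem1:
  fixes n N :: nat and A :: "complex mat" and \<eta>1 \<eta>2 :: "complex vec"
  assumes "n \<ge> 2" and "N \<ge> 1"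
    and "A \<in> carrier_mat (n - 1) (n - 1)"
    and "\<eta>1 \<in> carrier_vec n" and "\<forall>i<n. \<eta>1 $ i \<noteq> 0"
    and "\<eta>2 \<in> carrier_vec n" and "\<forall>i<n. \<eta>2 $ i \<noteq> 0"
  shows "(\<forall>m \<in> X n N. \<forall>m' \<in> X n N.
            (\<Sum>x \<in> X n N. b n x N \<eta>1 * \<phi> n N A x m * cnj (\<phi> n N A x m')) =
            (if m = m' then (\<Prod>j<n. (\<eta>2 $ j) ^ (m $ j)) / multinomial n N m else 0))
     \<longleftrightarrow>
         (\<exists>\<zeta>::complex. \<zeta> ^ N = 1 \<and>
            mat_adjoint (bordered n A) * mat_diag n (\<lambda>i. \<eta>1 $ i) * bordered n A =
            \<zeta> \<cdot>\<^sub>m mat_diag n (\<lambda>i. \<eta>2 $ i))"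
proof -
  have "bordered n A \<in> carrier_mat n n"
    by (simp add: bordered_def)
  then have M: "mat_adjoint (bordered n A) * mat_diag n (($) \<eta>1) * bordered n A \<in> carrier_mat n n"
    by (intro mult_carrier_mat[where n = n] mat_diag_dim) (auto simp: mat_adjoint_def)
  show ?thesis
    unfolding orthogonality_iff_forms_power_eq
    by (rule forms_power_eq_iff[OF M]) (use assms(1,2,7) in auto)
qed

end
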